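(* Let $D$ be an oriented graph with at least one arc and with maximum out-degree $\Delta^{+}$. Then $ow(D)\ge \dfrac{e(D)}{4\Delta^{+}}$.
   Context: An oriented graph $D$ is a finite directed graph without loops in which, for each pair of distinct vertices $x,y$, at most one of $\vec{xy},\vec{yx}$ is an arc. $e(D)$ is the number of arcs. For (not necessarily disjoint) $A,B\subseteq V(D)$, $e(A,B)$ is the number of arcs $\vec{xy}$ of $D$ with $x\in A$, $y\in B$. Define $ow(D)=\max\{e(A,B): A,B\subseteq V(D),\ e(B,A)=0\}$. *)

theory Defs
  imports Complex_Main "Graph_Theory.Digraph"
begin

locale oriented_graph = digraph G for G :: "('a, 'b) pre_digraph" (structure) +
  assumes oriented: "u \<rightarrow>\<^bsub>G\<^esub> v \<Longrightarrow> \<not> v \<rightarrow>\<^bsub>G\<^esub> u"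

definition num_arcs_between :: "('a, 'b) pre_digraph \<Rightarrow> 'a set \<Rightarrow> 'a set \<Rightarrow> nat" where
  "num_arcs_between G A B = card {e \<in> arcs G. tail G e \<in> A \<and> head G e \<in> B}"

text \<open>
  Both \<open>Max\<close> below are over finite nonempty sets for the graphs of interest:
  \<open>A = B = {}\<close> is always admissible in \<open>one_way\<close>, and \<open>max_out_degree\<close> is only
  meaningful if \<open>verts G\<close> is nonempty.
\<close>
definition one_way :: "('a, 'b) pre_digraph \<Rightarrow> nat" where
  "one_way G = Max {num_arcs_between G A B | A B.
     A \<subseteq> verts G \<and> B \<subseteq> verts G \<and> num_arcs_between G B A = 0}"

definition max_out_degree :: "('a, 'b) pre_digraph \<Rightarrow> nat" where
  "max_out_degree G = Max (out_degree G ` verts G)"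

end

theory Submission
  imports Defs
begin

text \<open>
  Put \<open>\<Delta> = max_out_degree D\<close> and colour the vertices with \<open>2\<Delta>\<close> colours so that among the directed
  walks \<open>x \<rightarrow> y \<rightarrow> z\<close>, of which there are at most \<open>e(D)\<Delta>\<close>, at most a fraction \<open>1 / (2\<Delta>)\<close> has
  equally coloured ends; such a walk has \<open>x \<noteq> z\<close> because \<open>D\<close> is oriented, so a greedy colouring
  works. Then at most half of the arcs \<open>x \<rightarrow> y\<close> extend to a walk with equally coloured ends. Let
  \<open>A\<close> be a colour class and \<open>B\<close> the set of vertices with no out-neighbour in \<open>A\<close>. Each
  remaining arc goes from \<open>A\<close> to \<open>B\<close> for one of the \<open>2\<Delta>\<close> colours, so one colour
  accounts for at least \<open>e(D) / (4\<Delta>)\<close> arcs.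
\<close>

lemma ex_below_average:
  fixes f :: "nat \<Rightarrow> nat"
  assumes "k > 0"
  shows "\<exists>i<k. k * f i \<le> (\<Sum>j<k. f j)"
proof (rule ccontr)
  assume "\<not> ?thesis"
  then have "(\<Sum>i<k. \<Sum>j<k. f j) < (\<Sum>i<k. k * f i)"
    using assms by (intro sum_strict_mono) (auto simp: not_le)
  then show False
    by (simp add: sum_distrib_left)
qed

text \<open>Vertices are coloured one at a time, and a pair is decided once its later end gets a
  colour. \<open>P\<close> is an abstract index set, so that pairs with the same two ends count with
  multiplicity.\<close>

lemma ex_coloring_few_monochromatic:
  fixes s t :: "'p \<Rightarrow> 'a" and k :: nat
  assumes "finite V" "finite P" "k > 0"
    and "\<And>p. p \<in> P \<Longrightarrow> s p \<in> V \<and> t p \<in> V \<and> s p \<noteq> t p"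
  shows "\<exists>c. (\<forall>x. c x < k) \<and> k * card {p \<in> P. c (s p) = c (t p)} \<le> card P"
  using assms(1,2,4)
proof (induction V arbitrary: P rule: finite_induct)
  case empty
  then have "P = {}" by auto
  then show ?case using \<open>k > 0\<close> by auto
next
  case (insert v V)
  \<comment> \<open>The pairs in \<open>Q\<close> avoid \<open>v\<close>, so the induction
    hypothesis settles them and recolouring \<open>v\<close> does not affect them.\<close>
  define Q where "Q = {p \<in> P. s p \<noteq> v \<and> t p \<noteq> v}"
  have "finite Q" "Q \<subseteq> P" using insert.prems by (auto simp: Q_def)
  moreover have "\<And>p. p \<in> Q \<Longrightarrow> s p \<in> V \<and> t p \<in> V \<and> s p \<noteq> t p"
    using insert.prems(2) unfolding Q_def by blast
  ultimately obtain c where c: "\<And>x. c x < k"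
    and cQ: "k * card {p \<in> Q. c (s p) = c (t p)} \<le> card Q"
    using insert.IH[of Q] by blast
  \<comment> \<open>For a pair at \<open>v\<close>, \<open>r p\<close> is its other end;
    \<open>N i\<close> collects the pairs that become monochromatic if \<open>v\<close> gets colour
    \<open>i\<close>. These sets partition \<open>P - Q\<close>, so some colour is at most
    average.\<close>
  define r where "r p = (if s p = v then t p else s p)" for p
  define N where "N i = {p \<in> P - Q. c (r p) = i}" for i
  have "P - Q = (\<Union>i<k. N i)"
    using c by (auto simp: N_def)
  moreover have "card (\<Union>i<k. N i) = (\<Sum>i<k. card (N i))"
    using insert.prems(1) by (intro card_UN_disjoint) (auto simp: N_def)
  ultimately obtain i where i: "i < k" "k * card (N i) \<le> card (P - Q)"
    using ex_below_average[OF \<open>k > 0\<close>, of "\<lambda>i. card (N i)"] by auto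
  let ?c = "c(v := i)"
  have "{p \<in> P. ?c (s p) = ?c (t p)} \<subseteq> {p \<in> Q. c (s p) = c (t p)} \<union> N i"
  proof
    fix p assume p: "p \<in> {p \<in> P. ?c (s p) = ?c (t p)}"
    then have "s p \<noteq> t p" using insert.prems(2) by blast
    then show "p \<in> {p \<in> Q. c (s p) = c (t p)} \<union> N i"
      using p by (cases "s p = v"; cases "t p = v") (simp_all add: Q_def N_def r_def)
  qed
  then have "card {p \<in> P. ?c (s p) = ?c (t p)} \<le> card ({p \<in> Q. c (s p) = c (t p)} \<union> N i)"
    using insert.prems(1) \<open>finite Q\<close> by (intro card_mono) (auto simp: N_def)
  also have "\<dots> \<le> card {p \<in> Q. c (s p) = c (t p)} + card (N i)"
    by (rule card_Un_le)
  finally have "k * card {p \<in> P. ?c (s p) = ?c (t p)}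
      \<le> k * (card {p \<in> Q. c (s p) = c (t p)} + card (N i))"
    by (rule mult_le_mono2)
  also have "\<dots> \<le> card Q + card (P - Q)"
    using add_mono[OF cQ i(2)] by (simp only: add_mult_distrib2)
  also have "\<dots> = card P"
    using \<open>Q \<subseteq> P\<close> \<open>finite Q\<close> insert.prems(1) by (simp add: card_Diff_subset card_mono)
  finally show ?case
    using c i(1) by (intro exI[of _ ?c]) auto
qed

lemma (in fin_digraph) num_arcs_between_le_one_way:
  assumes "A \<subseteq> verts G" "B \<subseteq> verts G" "num_arcs_between G B A = 0"
  shows "num_arcs_between G A B \<le> one_way G"
proof -
  let ?S = "{num_arcs_between G A B | A B.
     A \<subseteq> verts G \<and> B \<subseteq> verts G \<and> num_arcs_between G B A = 0}"
  \<comment> \<open>\<open>Max_ge\<close> needs a finite set; the bound by the number of arcs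
    provides this.\<close>
  have "?S \<subseteq> {..card (arcs G)}"
    by (auto simp: num_arcs_between_def intro!: card_mono)
  then have "finite ?S"
    by (rule finite_subset) simp
  then show ?thesis
    unfolding one_way_def using assms by (intro Max_ge) auto
qed

lemma (in fin_digraph) out_degree_le_max_out_degree:
  "v \<in> verts G \<Longrightarrow> out_degree G v \<le> max_out_degree G"
  unfolding max_out_degree_def by (intro Max_ge) auto

lemma (in fin_digraph) max_out_degree_pos:
  assumes "arcs G \<noteq> {}"
  shows "max_out_degree G > 0"
proof -
  obtain a where a: "a \<in> arcs G" using assms by blast
  then have "out_degree G (tail G a) > 0"
    by (auto simp: out_degree_def card_gt_0_iff)
  then show ?thesis
    using out_degree_le_max_out_degree[of "tail G a"] a by simp
qed

lemma (in fin_digraph) card_two_walks_le: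
  "card (SIGMA a:arcs G. out_arcs G (head G a)) \<le> card (arcs G) * max_out_degree G"
proof -
  have "card (SIGMA a:arcs G. out_arcs G (head G a)) = (\<Sum>a\<in>arcs G. out_degree G (head G a))"
    unfolding out_degree_def
    by (rule card_SigmaI) auto
  also have "\<dots> \<le> (\<Sum>a\<in>arcs G. max_out_degree G)"
    by (intro sum_mono out_degree_le_max_out_degree) simp
  finally show ?thesis by simp
qed

lemma (in fin_digraph) card_arcs_color_class_le:
  assumes c: "\<And>x. c x < k"
  shows "card {a \<in> arcs G. \<forall>b\<in>out_arcs G (head G a). c (head G b) \<noteq> c (tail G a)}
    \<le> k * one_way G"
proof -
  define A where "A i = {x \<in> verts G. c x = i}" for i
  define B where "B i = {y \<in> verts G. \<forall>b\<in>out_arcs G y. head G b \<notin> A i}" for i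
  let ?E = "\<lambda>i. {a \<in> arcs G. tail G a \<in> A i \<and> head G a \<in> B i}"
  \<comment> \<open>Take \<open>i\<close> to be the colour of the tail of \<open>a\<close>.\<close>
  have "{a \<in> arcs G. \<forall>b\<in>out_arcs G (head G a). c (head G b) \<noteq> c (tail G a)} \<subseteq> (\<Union>i<k. ?E i)"
    using c by (auto simp: A_def B_def)
  then have "card {a \<in> arcs G. \<forall>b\<in>out_arcs G (head G a). c (head G b) \<noteq> c (tail G a)}
      \<le> card (\<Union>i<k. ?E i)"
    by (intro card_mono) auto
  also have "\<dots> \<le> (\<Sum>i<k. card (?E i))"
    by (intro card_UN_le) simp
  also have "\<dots> \<le> (\<Sum>i<k. one_way G)"
  proof (rule sum_mono)
    fix i
    have "num_arcs_between G (B i) (A i) = 0"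
      by (auto simp: num_arcs_between_def B_def)
    then have "num_arcs_between G (A i) (B i) \<le> one_way G"
      by (intro num_arcs_between_le_one_way) (auto simp: A_def B_def)
    then show "card (?E i) \<le> one_way G"
      by (simp add: num_arcs_between_def)
  qed
  finally show ?thesis by simp
qed

lemma (in oriented_graph) card_arcs_le_one_way:
  assumes "arcs G \<noteq> {}"
  shows "card (arcs G) \<le> 4 * max_out_degree G * one_way G"
proof -
  let ?\<Delta> = "max_out_degree G"
  \<comment> \<open>A walk x \<rightarrow> y \<rightarrow> z is stored as its two consecutive
    arcs.\<close>
  define P where "P = (SIGMA a:arcs G. out_arcs G (head G a))"
  have \<Delta>: "?\<Delta> > 0" using assms by (rule max_out_degree_pos)
  have finP: "finite P" by (auto simp: P_def)
  \<comment> \<open>If the ends agreed, the second arc would reverse the first.\<close>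
  have "tail G (fst p) \<in> verts G \<and> head G (snd p) \<in> verts G \<and> tail G (fst p) \<noteq> head G (snd p)"
    if "p \<in> P" for p
  proof -
    from that have *: "fst p \<in> arcs G" "snd p \<in> arcs G" "tail G (snd p) = head G (fst p)"
      by (auto simp: P_def)
    then show ?thesis
      using oriented[of "tail G (fst p)" "head G (fst p)"]
        dominatesI[of "fst p"] dominatesI[of "snd p"]
      by (auto simp: arc_to_ends_def)
  qed
  then obtain c where c: "\<And>x. c x < 2 * ?\<Delta>"
    and cP: "2 * ?\<Delta> * card {p \<in> P. c (tail G (fst p)) = c (head G (snd p))} \<le> card P"
    using ex_coloring_few_monochromatic[of "verts G" P "2 * ?\<Delta>" "\<lambda>p. tail G (fst p)"
        "\<lambda>p. head G (snd p)"] finP \<Delta> by auto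
  define M where "M = {p \<in> P. c (tail G (fst p)) = c (head G (snd p))}"
  define K where "K = {a \<in> arcs G. \<forall>b\<in>out_arcs G (head G a). c (head G b) \<noteq> c (tail G a)}"
  have finM: "finite M" using finP by (simp add: M_def)
  \<comment> \<open>An arc outside \<open>K\<close> starts some walk with equally coloured
    ends.\<close>
  have "arcs G \<subseteq> K \<union> fst ` M"
    by (force simp: K_def M_def P_def)
  then have "card (arcs G) \<le> card (K \<union> fst ` M)"
    using finM by (intro card_mono) (auto simp: K_def)
  also have "\<dots> \<le> card K + card (fst ` M)"
    by (rule card_Un_le)
  also have "\<dots> \<le> card K + card M"
    using finM by (simp add: card_image_le)
  finally have split: "card (arcs G) \<le> card K + card M" .
  have "2 * ?\<Delta> * card M \<le> card (arcs G) * ?\<Delta>"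
    using cP card_two_walks_le unfolding M_def P_def by (rule order_trans)
  \<comment> \<open>The factor 2 in the number of colours survives the cancellation, leaving at
    least half of the arcs in \<open>K\<close>.\<close>
  then have "2 * card M \<le> card (arcs G)"
    using \<Delta> by simp
  moreover have "card K \<le> 2 * ?\<Delta> * one_way G"
    unfolding K_def using c by (rule card_arcs_color_class_le)
  ultimately show ?thesis
    using split by linarith
qed

theorem proposition6p3:
  fixes D :: "('a, 'b) pre_digraph"
  assumes "oriented_graph D"
    and "arcs D \<noteq> {}"
  shows "real (one_way D) \<ge> real (card (arcs D)) / (4 * real (max_out_degree D))"
proof -
  interpret oriented_graph D by fact
  have "real (card (arcs D)) \<le> real (4 * max_out_degree D * one_way D)"
    using card_arcs_le_one_way[OF assms(2)] by (rule of_nat_mono)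
  then show ?thesis
    using max_out_degree_pos[OF assms(2)] by (simp add: divide_le_eq mult.commute mult.left_commute)
qed

end
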